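(* Let $(H;\langle\cdot,\cdot\rangle)$ be a real or complex inner product space over $\mathbb{K}$ ($\mathbb{K}=\mathbb{R}$ or $\mathbb{K}=\mathbb{C}$), let $\Gamma,\gamma\in\mathbb{K}$ with $\operatorname{Re}(\Gamma\bar\gamma)>0$, and let $x,y_j\in H$, $j\in\{1,\dots,n\}$, be such that either $$(\operatorname{Re}\Gamma-\operatorname{Re}\langle x,y_j\rangle)(\operatorname{Re}\langle x,y_j\rangle-\operatorname{Re}\gamma)+(\operatorname{Im}\Gamma-\operatorname{Im}\langle x,y_j\rangle)(\operatorname{Im}\langle x,y_j\rangle-\operatorname{Im}\gamma)\geq 0$$ for each $j\in\{1,\dots,n\}$ or, equivalently, $$\left|\langle x,y_j\rangle-\frac{\gamma+\Gamma}{2}\right|\leq\frac12|\Gamma-\gamma|$$ for each $j\in\{1,\dots,n\}$. Then $$\sum_{j=1}^{n}|\langle x,y_j\rangle|^2\leq\frac1n\cdot\frac{|\Gamma+\gamma|^2}{4\operatorname{Re}(\Gamma\bar\gamma)}\left\|\sum_{j=1}^{n}y_j\right\|^2\|x\|^2.$$ Moreover, for $x\neq 0$, equality holds in this last inequality if and only if $$\left|\langle x,y_j\rangle-\frac{\gamma+\Gamma}{2}\right|=\frac12|\Gamma-\gamma|\quad\text{for each } j\in\{1,\dots,n\}$$ and $$\frac1n\sum_{j=1}^{n}y_j=\frac{2\operatorname{Re}(\Gamma\bar\gamma)}{(\Gamma+\gamma)\|x\|^2}\cdot x.$$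
   Context: $n\geq 1$ is an integer. The inner product $\langle\cdot,\cdot\rangle$ is linear in the first argument and conjugate-linear in the second, and $\|x\|=\langle x,x\rangle^{1/2}$. $\operatorname{Re}$, $\operatorname{Im}$ and the bar denote real part, imaginary part and complex conjugation (when $\mathbb{K}=\mathbb{R}$, imaginary parts are $0$ and conjugation is trivial). *)

theory Defs
  imports "HOL-Analysis.Inner_Product"
begin

text \<open>
  The scalar field \<open>\<real>\<close> or \<open>\<complex>\<close>, treated uniformly. Real part, imaginary part and conjugation of a
  scalar \<open>z\<close> are taken through its value \<open>to_complex z\<close>; \<open>norm z\<close> is its modulus.
\<close>

class real_or_complex = real_normed_field +
  fixes to_complex :: "'a \<Rightarrow> complex"
  assumes to_complex_add: "to_complex (a + b) = to_complex a + to_complex b"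
    and to_complex_mult: "to_complex (a * b) = to_complex a * to_complex b"
    and to_complex_one: "to_complex 1 = 1"
    and to_complex_scaleR: "to_complex (r *\<^sub>R a) = r *\<^sub>R to_complex a"
    and cmod_to_complex: "cmod (to_complex a) = norm a"
    and range_to_complex: "range to_complex = \<real> \<or> range to_complex = UNIV"

instantiation real :: real_or_complex
begin
definition to_complex_real :: "real \<Rightarrow> complex" where "to_complex_real = complex_of_real"
instance by standard (simp_all add: to_complex_real_def Reals_def scaleR_conv_of_real)
end

instantiation complex :: real_or_complex
begin
definition to_complex_complex :: "complex \<Rightarrow> complex" where "to_complex_complex z = z"
instance
proof
  show "range (to_complex :: complex \<Rightarrow> complex) = \<real> \<or> range (to_complex :: complex \<Rightarrow> complex) = UNIV"
    by (simp add: to_complex_complex_def)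
qed (simp_all add: to_complex_complex_def)
end

locale inner_product_space = vector_space scale
  for scale :: "'k::real_or_complex \<Rightarrow> 'v::ab_group_add \<Rightarrow> 'v" +
  fixes ip :: "'v \<Rightarrow> 'v \<Rightarrow> 'k"
  assumes ip_add_left: "ip (u + v) w = ip u w + ip v w"
    and ip_scale_left: "ip (scale a u) v = a * ip u v"
    and ip_commute: "to_complex (ip u v) = cnj (to_complex (ip v u))"
    and ip_pos: "u \<noteq> 0 \<Longrightarrow> Re (to_complex (ip u u)) > 0"

text \<open>By conjugate symmetry \<open>ip u u\<close> is real, so its square root is that of its real part.\<close>

definition ip_norm :: "('v \<Rightarrow> 'v \<Rightarrow> 'k::real_or_complex) \<Rightarrow> 'v \<Rightarrow> real" where
  "ip_norm ip u = sqrt (Re (to_complex (ip u u)))"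

lemma inner_product_space_real_inner:
  "inner_product_space (scaleR :: real \<Rightarrow> 'a::real_inner \<Rightarrow> 'a) inner"
  by unfold_locales
    (simp_all add: to_complex_real_def scaleR_add_right scaleR_add_left inner_add_left,
     simp add: inner_commute)

lemma ip_norm_real_inner: "ip_norm (inner :: 'a::real_inner \<Rightarrow> 'a \<Rightarrow> real) u = norm u"
  by (simp add: ip_norm_def to_complex_real_def norm_eq_sqrt_inner)

lemma inner_product_space_complex:
  "inner_product_space ((*) :: complex \<Rightarrow> complex \<Rightarrow> complex) (\<lambda>u v. u * cnj v)"
proof unfold_locales
  fix u :: complex
  assume "u \<noteq> 0"
  then show "Re (to_complex (u * cnj u)) > 0"
    by (simp add: to_complex_complex_def complex_mult_cnj complex_neq_0)
qed (simp_all add: to_complex_complex_def distrib_left distrib_right mult.commute)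

lemma ip_norm_complex: "ip_norm (\<lambda>u v. u * cnj v) (u :: complex) = cmod u"
  by (simp add: ip_norm_def to_complex_complex_def cmod_def power2_eq_square)

end

theory Submission
  imports Defs
begin

text \<open>
  Write \<open>z\<^sub>j = \<langle>x, y\<^sub>j\<rangle>\<close>, \<open>S = \<Gamma> + \<gamma>\<close>, \<open>p = Re (\<Gamma> cnj \<gamma>)\<close> and \<open>m = (1/n) \<Sum>y\<^sub>j\<close>. The usual route adds up the
  disc conditions, each of which reads \<open>|z\<^sub>j|\<^sup>2 + p \<le> Re (cnj S * z\<^sub>j)\<close>, and then applies the Schwarz
  inequality to \<open>\<langle>x, m\<rangle>\<close> and the arithmetic-geometric mean inequality. The losses of all these steps
  can be collected into a single identity, valid for all \<open>x \<noteq> 0\<close> and all \<open>y\<^sub>j\<close>: the right side of the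
  asserted inequality minus the left side equals

  \<open>n |S|\<^sup>2 \<parallel>x\<parallel>\<^sup>2 / (4p) * \<parallel>m - d x\<parallel>\<^sup>2 + \<Sum>\<^sub>j (|\<Gamma> - \<gamma>|\<^sup>2 / 4 - |z\<^sub>j - S / 2|\<^sup>2)\<close>,
  where \<open>d = 2p / (S \<parallel>x\<parallel>\<^sup>2)\<close>.

  As \<open>p > 0\<close> forces \<open>S \<noteq> 0\<close>, the first term is nonnegative, and it vanishes exactly
  if \<open>m = d x\<close>; the disc condition says that each summand of the second term is nonnegative. This yields the inequality and the equality case together
  (\<open>reverse_inequality_defect\<close>). The two forms of the disc condition agree because the quadratic form in
  the first is the power of the point \<open>z\<^sub>j\<close> with respect to the circle with diameter \<open>[\<gamma>, \<Gamma>]\<close>, up to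
  sign (\<open>disc_defect\<close>).
\<close>

section \<open>Scalars\<close>

text \<open>
  The map \<^const>\<open>to_complex\<close> is an isometric embedding of fields over the reals, so that every
  computation with scalars can be carried out in the complex numbers.
\<close>

lemma to_complex_of_real [simp]: "to_complex (of_real r) = of_real r"
  by (simp add: of_real_def to_complex_scaleR to_complex_one)

lemma to_complex_0 [simp]: "to_complex 0 = 0"
  using to_complex_of_real[of 0] by simp

lemma to_complex_of_nat [simp]: "to_complex (of_nat k) = of_nat k"
  using to_complex_of_real[of "real k"] by simp

lemma to_complex_numeral [simp]: "to_complex (numeral k) = numeral k"
  using to_complex_of_real[of "numeral k"] by simp

lemma to_complex_diff: "to_complex (a - b) = to_complex a - to_complex b"
  using to_complex_add[of "a - b" b] by simp

lemma to_complex_divide: "to_complex (a / b) = to_complex a / to_complex b"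
proof (cases "b = 0")
  case False
  then have "to_complex b \<noteq> 0"
    using cmod_to_complex[of b] by auto
  moreover have "to_complex (a / b) * to_complex b = to_complex a"
    using False by (simp flip: to_complex_mult)
  ultimately show ?thesis
    by (simp add: field_simps)
qed simp

lemma disc_defect:
  fixes G g z :: "'k::real_or_complex"
  shows "(Re (to_complex G) - Re (to_complex z)) * (Re (to_complex z) - Re (to_complex g))
      + (Im (to_complex G) - Im (to_complex z)) * (Im (to_complex z) - Im (to_complex g))
    = (1 / 2 * norm (G - g))\<^sup>2 - (norm (z - (g + G) / 2))\<^sup>2"
proof -
  have diameter: "norm (G - g) = cmod (to_complex G - to_complex g)"
    by (simp add: cmod_to_complex flip: to_complex_diff)
  have distance: "norm (z - (g + G) / 2)
      = cmod (to_complex z - (to_complex g + to_complex G) / 2)"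
    by (simp add: cmod_to_complex[of "z - (g + G) / 2", symmetric]
        to_complex_add to_complex_diff to_complex_divide)
  show ?thesis
    unfolding diameter distance
    by (simp add: cmod_power2 power_divide) (simp add: field_simps power2_eq_square)
qed

text \<open>
  In this form the defect can be summed over \<open>j\<close>: apart from \<open>|z\<^sub>j|\<^sup>2\<close> it is affine in \<open>z\<^sub>j\<close>, so that the
  vectors enter only through their sum.
\<close>

lemma disc_defect_expand:
  fixes G g z :: complex
  shows "(Re G - Re z) * (Re z - Re g) + (Im G - Im z) * (Im z - Im g)
    = Re (cnj (G + g) * z) - (cmod z)\<^sup>2 - Re (G * cnj g)"
  by (simp add: cmod_power2) (simp add: algebra_simps power2_eq_square)

lemma sum_nonzero_if_Re_mult_cnj_pos:
  assumes "Re (G * cnj g) > 0"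
  shows "G + g \<noteq> 0"
proof
  assume "G + g = 0"
  then have "G = - g"
    by (simp add: eq_neg_iff_add_eq_0)
  then have "Re (G * cnj g) = - ((Re g)\<^sup>2 + (Im g)\<^sup>2)"
    by (simp add: power2_eq_square)
  also have "\<dots> \<le> 0"
    by simp
  finally show False
    using assms by simp
qed

section \<open>The defect of the reverse inequality\<close>

context inner_product_space
begin

lemma ip_zero_left [simp]: "ip 0 v = 0"
  using ip_add_left[of 0 0 v] by simp

lemma ip_diff_left: "ip (u - v) w = ip u w - ip v w"
  using ip_add_left[of "u - v" v w] by simp

lemma ip_add_right: "to_complex (ip u (v + w)) = to_complex (ip u v) + to_complex (ip u w)"
  by (metis ip_commute ip_add_left to_complex_add complex_cnj_add)

lemma ip_diff_right: "to_complex (ip u (v - w)) = to_complex (ip u v) - to_complex (ip u w)"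
  by (metis ip_commute ip_diff_left to_complex_diff complex_cnj_diff)

lemma ip_scale_right:
  "to_complex (ip u (scale a v)) = cnj (to_complex a) * to_complex (ip u v)"
  by (metis ip_commute ip_scale_left to_complex_mult complex_cnj_mult)

lemma ip_sum_right:
  "finite J \<Longrightarrow> to_complex (ip u (\<Sum>j\<in>J. y j)) = (\<Sum>j\<in>J. to_complex (ip u (y j)))"
proof (induction J rule: finite_induct)
  case empty
  show ?case
    using ip_commute[of u 0] by simp
qed (simp add: ip_add_right)

lemma ip_norm_power2: "(ip_norm ip u)\<^sup>2 = Re (to_complex (ip u u))"
  using ip_pos[of u] by (cases "u = 0") (auto simp: ip_norm_def)

lemma ip_norm_eq_0_iff: "ip_norm ip u = 0 \<longleftrightarrow> u = 0"
  using ip_pos[of u] by (cases "u = 0") (auto simp: ip_norm_def)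

lemma ip_self: "to_complex (ip u u) = of_real ((ip_norm ip u)\<^sup>2)"
proof -
  have "Im (to_complex (ip u u)) = 0"
    using arg_cong[OF ip_commute[of u u], of Im] by simp
  then show ?thesis
    by (simp add: ip_norm_power2 complex_eq_iff)
qed

lemma ip_norm_scale_power2:
  "(ip_norm ip (scale a u))\<^sup>2 = (norm a)\<^sup>2 * (ip_norm ip u)\<^sup>2"
proof -
  have "to_complex (ip (scale a u) (scale a u))
      = (to_complex a * cnj (to_complex a)) * of_real ((ip_norm ip u)\<^sup>2)"
    by (simp add: ip_scale_left ip_scale_right to_complex_mult ip_self mult_ac)
  also have "\<dots> = of_real ((norm a)\<^sup>2 * (ip_norm ip u)\<^sup>2)"
    by (simp only: complex_norm_square[symmetric] cmod_to_complex of_real_mult)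
  finally show ?thesis
    by (simp only: ip_norm_power2[of "scale a u"] Re_complex_of_real)
qed

lemma ip_norm_diff_scale_power2:
  "(ip_norm ip (v - scale a u))\<^sup>2
    = (ip_norm ip v)\<^sup>2 - 2 * Re (to_complex a * to_complex (ip u v))
      + (norm a)\<^sup>2 * (ip_norm ip u)\<^sup>2"
proof -
  have "Re (to_complex (ip v (scale a u))) = Re (to_complex a * to_complex (ip u v))"
    by (subst ip_commute) (simp add: ip_scale_left to_complex_mult)
  then show ?thesis
    unfolding ip_norm_scale_power2[symmetric]
    by (simp add: ip_norm_power2 ip_diff_left ip_diff_right to_complex_diff
        ip_scale_left[of a u v] to_complex_mult)
qed

text \<open>
  Expanding \<open>\<parallel>m - d x\<parallel>\<^sup>2\<close> gives the terms \<open>\<parallel>m\<parallel>\<^sup>2\<close>, \<open>- 2 Re (d \<langle>x, m\<rangle>)\<close> and \<open>|d|\<^sup>2 \<parallel>x\<parallel>\<^sup>2\<close>. The choice of \<open>d\<close>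
  is the one that turns the last two, after multiplication by \<open>n |S|\<^sup>2 \<parallel>x\<parallel>\<^sup>2 / (4p)\<close>, into
  \<open>- \<Sum>Re (cnj S * z\<^sub>j)\<close> and \<open>n p\<close>. These are the terms of the disc defects other than \<open>- \<Sum>|z\<^sub>j|\<^sup>2\<close>, with
  the opposite sign.
\<close>

lemma reverse_inequality_defect:
  fixes \<Gamma> \<gamma> :: 'k and x :: 'v and y :: "'i \<Rightarrow> 'v" and J :: "'i set"
  defines "p \<equiv> Re (to_complex \<Gamma> * cnj (to_complex \<gamma>))"
  defines "d \<equiv> of_real (2 * p) / ((\<Gamma> + \<gamma>) * of_real ((ip_norm ip x)\<^sup>2))"
  assumes "finite J" "J \<noteq> {}" "x \<noteq> 0" "p > 0"
  shows "1 / real (card J) * ((norm (\<Gamma> + \<gamma>))\<^sup>2 / (4 * p))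
            * (ip_norm ip (\<Sum>j\<in>J. y j))\<^sup>2 * (ip_norm ip x)\<^sup>2
          - (\<Sum>j\<in>J. (norm (ip x (y j)))\<^sup>2)
        = real (card J) * (norm (\<Gamma> + \<gamma>))\<^sup>2 * (ip_norm ip x)\<^sup>2 / (4 * p)
            * (ip_norm ip (scale (1 / of_nat (card J)) (\<Sum>j\<in>J. y j) - scale d x))\<^sup>2
          + (\<Sum>j\<in>J. (1 / 2 * norm (\<Gamma> - \<gamma>))\<^sup>2 - (norm (ip x (y j) - (\<gamma> + \<Gamma>) / 2))\<^sup>2)"
proof -
  define n where "n = real (card J)"
  define S where "S = to_complex (\<Gamma> + \<gamma>)"
  define s where "s = (cmod S)\<^sup>2"
  define A where "A = (ip_norm ip x)\<^sup>2"
  define Y where "Y = (ip_norm ip (\<Sum>j\<in>J. y j))\<^sup>2"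
  define z where "z j = to_complex (ip x (y j))" for j
  define R where "R = Re (cnj S * (\<Sum>j\<in>J. z j))"
  have "n > 0"
    using assms by (simp add: n_def card_gt_0_iff)
  have "A > 0"
    using \<open>x \<noteq> 0\<close> by (simp add: A_def ip_norm_eq_0_iff)
  have "S \<noteq> 0"
    using sum_nonzero_if_Re_mult_cnj_pos \<open>p > 0\<close> by (simp add: S_def p_def to_complex_add)
  then have "s > 0"
    by (simp add: s_def)
  have norm_S: "(norm (\<Gamma> + \<gamma>))\<^sup>2 = s"
    by (simp add: s_def S_def cmod_to_complex)
  have d: "to_complex d = of_real (2 * p / (s * A)) * cnj S"
  proof -
    have "to_complex d = of_real (2 * p) / (S * of_real A)"
      by (simp only: d_def S_def A_def to_complex_divide to_complex_mult to_complex_of_real)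
    moreover have "of_real s = S * cnj S"
      by (simp only: s_def complex_norm_square)
    ultimately show ?thesis
      using \<open>S \<noteq> 0\<close> \<open>A > 0\<close> by (simp add: field_simps)
  qed
  have norm_d: "(norm d)\<^sup>2 = 4 * p\<^sup>2 / (s * A\<^sup>2)"
  proof -
    have "(norm d)\<^sup>2 = (2 * p / (s * A))\<^sup>2 * s"
      unfolding cmod_to_complex[of d, symmetric] d norm_mult power_mult_distrib
      by (simp only: s_def norm_of_real power2_abs complex_mod_cnj)
    also have "\<dots> = 4 * p\<^sup>2 / (s * A\<^sup>2)"
      using \<open>s > 0\<close> \<open>A > 0\<close> by (simp add: field_simps power2_eq_square)
    finally show ?thesis .
  qed
  have cross: "Re (to_complex d * to_complex (ip x (scale (1 / of_nat (card J)) (\<Sum>j\<in>J. y j))))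
      = 2 * p / (s * A * n) * R"
  proof -
    have "to_complex d * to_complex (ip x (scale (1 / of_nat (card J)) (\<Sum>j\<in>J. y j)))
        = of_real (2 * p / (s * A * n)) * (cnj S * (\<Sum>j\<in>J. z j))"
      using \<open>finite J\<close>
      by (simp add: d ip_scale_right ip_sum_right z_def n_def to_complex_divide to_complex_one)
    then show ?thesis
      by (simp only: R_def Re_complex_of_real complex_scaleR scaleR_conv_of_real[symmetric]
          scaleR_complex.sel real_scaleR_def)
  qed
  have norm_mean: "(ip_norm ip (scale (1 / of_nat (card J)) (\<Sum>j\<in>J. y j)))\<^sup>2 = Y / n\<^sup>2"
    by (simp add: ip_norm_scale_power2 Y_def n_def norm_divide power_divide)
  have defects: "(\<Sum>j\<in>J. (1 / 2 * norm (\<Gamma> - \<gamma>))\<^sup>2 - (norm (ip x (y j) - (\<gamma> + \<Gamma>) / 2))\<^sup>2)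
      = R - (\<Sum>j\<in>J. (norm (ip x (y j)))\<^sup>2) - n * p"
  proof -
    have "(1 / 2 * norm (\<Gamma> - \<gamma>))\<^sup>2 - (norm (ip x (y j) - (\<gamma> + \<Gamma>) / 2))\<^sup>2
        = Re (cnj S * z j) - (norm (ip x (y j)))\<^sup>2 - p" for j
      using disc_defect[of \<Gamma> "ip x (y j)" \<gamma>]
        disc_defect_expand[of "to_complex \<Gamma>" "z j" "to_complex \<gamma>"]
      by (simp add: S_def z_def p_def to_complex_add cmod_to_complex)
    then have "(\<Sum>j\<in>J. (1 / 2 * norm (\<Gamma> - \<gamma>))\<^sup>2 - (norm (ip x (y j) - (\<gamma> + \<Gamma>) / 2))\<^sup>2)
        = (\<Sum>j\<in>J. Re (cnj S * z j) - (norm (ip x (y j)))\<^sup>2 - p)"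
      by simp
    also have "\<dots> = R - (\<Sum>j\<in>J. (norm (ip x (y j)))\<^sup>2) - n * p"
      by (simp only: sum_subtractf R_def n_def sum_constant sum_distrib_left Re_sum)
    finally show ?thesis .
  qed
  have "1 / n * (s / (4 * p)) * Y * A
      = n * s * A / (4 * p) * (Y / n\<^sup>2 - 2 * (2 * p / (s * A * n) * R) + 4 * p\<^sup>2 / (s * A\<^sup>2) * A)
        + (R - n * p)"
    using \<open>n > 0\<close> \<open>s > 0\<close> \<open>A > 0\<close> \<open>p > 0\<close> by (simp add: field_simps power2_eq_square)
  then show ?thesis
    unfolding ip_norm_diff_scale_power2 defects cross norm_mean norm_d norm_S
      n_def[symmetric] A_def[symmetric] Y_def[symmetric]
    by simp
qed

end

section \<open>The reverse inequality and its equality case\<close>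

theorem theorem10:
  fixes scale :: "'k::real_or_complex \<Rightarrow> 'v::ab_group_add \<Rightarrow> 'v"
    and ip :: "'v \<Rightarrow> 'v \<Rightarrow> 'k"
    and \<Gamma> \<gamma> :: 'k
    and n :: nat
    and x :: 'v
    and y :: "nat \<Rightarrow> 'v"
  assumes "inner_product_space scale ip"
    and "n \<ge> 1"
    and "Re (to_complex \<Gamma> * cnj (to_complex \<gamma>)) > 0"
  shows "((\<forall>j\<in>{1..n}.
              (Re (to_complex \<Gamma>) - Re (to_complex (ip x (y j)))) *
              (Re (to_complex (ip x (y j))) - Re (to_complex \<gamma>)) +
              (Im (to_complex \<Gamma>) - Im (to_complex (ip x (y j)))) *
              (Im (to_complex (ip x (y j))) - Im (to_complex \<gamma>)) \<ge> 0)
          \<longleftrightarrow> (\<forall>j\<in>{1..n}. norm (ip x (y j) - (\<gamma> + \<Gamma>) / 2) \<le> 1 / 2 * norm (\<Gamma> - \<gamma>)))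
    \<and> ((\<forall>j\<in>{1..n}.
              (Re (to_complex \<Gamma>) - Re (to_complex (ip x (y j)))) *
              (Re (to_complex (ip x (y j))) - Re (to_complex \<gamma>)) +
              (Im (to_complex \<Gamma>) - Im (to_complex (ip x (y j)))) *
              (Im (to_complex (ip x (y j))) - Im (to_complex \<gamma>)) \<ge> 0)
          \<or> (\<forall>j\<in>{1..n}. norm (ip x (y j) - (\<gamma> + \<Gamma>) / 2) \<le> 1 / 2 * norm (\<Gamma> - \<gamma>))
        \<longrightarrow>
          (\<Sum>j=1..n. (norm (ip x (y j)))\<^sup>2)
            \<le> 1 / real n * ((norm (\<Gamma> + \<gamma>))\<^sup>2 / (4 * Re (to_complex \<Gamma> * cnj (to_complex \<gamma>))))
                * (ip_norm ip (\<Sum>j=1..n. y j))\<^sup>2 * (ip_norm ip x)\<^sup>2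
          \<and> (x \<noteq> 0 \<longrightarrow>
              ((\<Sum>j=1..n. (norm (ip x (y j)))\<^sup>2)
                = 1 / real n * ((norm (\<Gamma> + \<gamma>))\<^sup>2 / (4 * Re (to_complex \<Gamma> * cnj (to_complex \<gamma>))))
                    * (ip_norm ip (\<Sum>j=1..n. y j))\<^sup>2 * (ip_norm ip x)\<^sup>2
               \<longleftrightarrow>
                 (\<forall>j\<in>{1..n}. norm (ip x (y j) - (\<gamma> + \<Gamma>) / 2) = 1 / 2 * norm (\<Gamma> - \<gamma>))
                 \<and> scale (1 / of_nat n) (\<Sum>j=1..n. y j)
                     = scale (of_real (2 * Re (to_complex \<Gamma> * cnj (to_complex \<gamma>)))
                              / ((\<Gamma> + \<gamma>) * of_real ((ip_norm ip x)\<^sup>2))) x)))"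
proof -
  interpret inner_product_space scale ip
    by fact
  define p where "p = Re (to_complex \<Gamma> * cnj (to_complex \<gamma>))"
  define r where "r = 1 / 2 * norm (\<Gamma> - \<gamma>)"
  define \<rho> where "\<rho> j = norm (ip x (y j) - (\<gamma> + \<Gamma>) / 2)" for j
  define Q where "Q j = (Re (to_complex \<Gamma>) - Re (to_complex (ip x (y j)))) *
              (Re (to_complex (ip x (y j))) - Re (to_complex \<gamma>)) +
              (Im (to_complex \<Gamma>) - Im (to_complex (ip x (y j)))) *
              (Im (to_complex (ip x (y j))) - Im (to_complex \<gamma>))" for j
  define L where "L = (\<Sum>j=1..n. (norm (ip x (y j)))\<^sup>2)"
  define B where "B = 1 / real n * ((norm (\<Gamma> + \<gamma>))\<^sup>2 / (4 * p))
                * (ip_norm ip (\<Sum>j=1..n. y j))\<^sup>2 * (ip_norm ip x)\<^sup>2"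
  define m where "m = scale (1 / of_nat n) (\<Sum>j=1..n. y j)"
  define w where "w = scale (of_real (2 * p) / ((\<Gamma> + \<gamma>) * of_real ((ip_norm ip x)\<^sup>2))) x"
  have "p > 0"
    using assms(3) by (simp add: p_def)
  have "r \<ge> 0" and \<rho>_nonneg: "\<rho> j \<ge> 0" for j
    by (simp_all add: r_def \<rho>_def)
  have "Q j = r\<^sup>2 - (\<rho> j)\<^sup>2" for j
    unfolding Q_def r_def \<rho>_def by (rule disc_defect)
  then have disc: "Q j \<ge> 0 \<longleftrightarrow> \<rho> j \<le> r" for j
    using \<open>r \<ge> 0\<close> \<rho>_nonneg by (simp add: power_mono_iff)
  have main: "L \<le> B \<and> (x \<noteq> 0 \<longrightarrow> (L = B \<longleftrightarrow> (\<forall>j\<in>{1..n}. \<rho> j = r) \<and> m = w))"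
    if le: "\<forall>j\<in>{1..n}. \<rho> j \<le> r"
  proof (cases "x = 0")
    case True
    then show ?thesis
      by (simp add: L_def B_def ip_norm_def)
  next
    case False
    define K where "K = real n * (norm (\<Gamma> + \<gamma>))\<^sup>2 * (ip_norm ip x)\<^sup>2 / (4 * p)"
    have "to_complex (\<Gamma> + \<gamma>) \<noteq> 0"
      using sum_nonzero_if_Re_mult_cnj_pos[OF assms(3)] by (simp add: to_complex_add)
    then have "\<Gamma> + \<gamma> \<noteq> 0"
      by auto
    then have "K > 0"
      using \<open>p > 0\<close> \<open>n \<ge> 1\<close> False by (simp add: K_def ip_norm_eq_0_iff)
    have defect: "B - L = K * (ip_norm ip (m - w))\<^sup>2 + (\<Sum>j=1..n. r\<^sup>2 - (\<rho> j)\<^sup>2)"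
      using reverse_inequality_defect[of "{1..n}" x \<Gamma> \<gamma> y] \<open>p > 0\<close> \<open>n \<ge> 1\<close> False
      unfolding B_def L_def K_def m_def w_def r_def \<rho>_def p_def by simp
    have summand: "r\<^sup>2 - (\<rho> j)\<^sup>2 \<ge> 0" if "j \<in> {1..n}" for j
      using le that \<rho>_nonneg[of j] by (simp add: power_mono)
    have terms: "K * (ip_norm ip (m - w))\<^sup>2 \<ge> 0" "(\<Sum>j=1..n. r\<^sup>2 - (\<rho> j)\<^sup>2) \<ge> 0"
      using \<open>K > 0\<close> by (simp, intro sum_nonneg summand)
    have "L = B \<longleftrightarrow> (\<Sum>j=1..n. r\<^sup>2 - (\<rho> j)\<^sup>2) = 0 \<and> K * (ip_norm ip (m - w))\<^sup>2 = 0"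
      using defect terms by linarith
    also have "(\<Sum>j=1..n. r\<^sup>2 - (\<rho> j)\<^sup>2) = 0 \<longleftrightarrow> (\<forall>j\<in>{1..n}. r\<^sup>2 - (\<rho> j)\<^sup>2 = 0)"
      using summand by (intro sum_nonneg_eq_0_iff) auto
    also have "\<dots> \<longleftrightarrow> (\<forall>j\<in>{1..n}. \<rho> j = r)"
      using \<open>r \<ge> 0\<close> \<rho>_nonneg by (auto simp: power2_eq_iff_nonneg)
    also have "K * (ip_norm ip (m - w))\<^sup>2 = 0 \<longleftrightarrow> m = w"
      using \<open>K > 0\<close> by (simp add: ip_norm_eq_0_iff)
    finally show ?thesis
      using defect terms by linarith
  qed
  have "((\<forall>j\<in>{1..n}. Q j \<ge> 0) \<longleftrightarrow> (\<forall>j\<in>{1..n}. \<rho> j \<le> r))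
    \<and> ((\<forall>j\<in>{1..n}. Q j \<ge> 0) \<or> (\<forall>j\<in>{1..n}. \<rho> j \<le> r)
       \<longrightarrow> L \<le> B \<and> (x \<noteq> 0 \<longrightarrow> (L = B \<longleftrightarrow> (\<forall>j\<in>{1..n}. \<rho> j = r) \<and> m = w)))"
    using main by (simp add: disc)
  then show ?thesis
    unfolding Q_def \<rho>_def r_def L_def B_def m_def w_def p_def .
qed

end
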